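(* There is a real number $C$ with the following property. For every positive integer $k$ there is $n_0$ such that for all $n \geq n_0$, $s(n, \chi_{>k}) \geq \left(1 - C\frac{\log k}{k}\right)\binom{n}{2}$. This holds both when Mini moves first and when Max moves first.
   Context: Let $\mathcal{P}$ be a monotone increasing property of graphs on vertex set $[n]$. An edge $e \in \binom{[n]}{2}\setminus E(G)$ is legal with respect to a graph $G \notin \mathcal{P}$ if $G \cup \{e\} \notin \mathcal{P}$. The saturation game $(n,\mathcal{P})$: starting from the empty graph on $[n]$, two players, Mini and Max, alternately add a legal edge to the current graph $G$. The game ends when no legal edge exists. Max wants to maximize the number of edges of the final graph and Mini wants to minimize it. The score $s(n,\mathcal{P})$ is the number of edges of the final graph under optimal play by both players; it may depend on which player moves first. $\chi_{>k}$ denotes the property of having chromatic number at least $k+1$. $\log$ is the natural logarithm.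
   Formalization: The formal statement takes k ≥ 2 instead of every positive integer k: at k = 1 the claim is false, since log 1 = 0 makes the bound binom(n,2) while no edge is ever legal, so the score is 0. *)

theory Defs
  imports Complex_Main
begin

text \<open>A graph on the vertex set $[n]$ is given by its edge set, a subset of \<open>all_edges n\<close>.
  A graph property is a predicate on edge sets.\<close>

definition all_edges :: "nat \<Rightarrow> nat set set" where
  "all_edges n = {e. e \<subseteq> {1..n} \<and> card e = 2}"

lemma finite_all_edges [simp]: "finite (all_edges n)"
  by (rule finite_subset [of _ "Pow {1..n}"]) (auto simp: all_edges_def)

definition colorable :: "nat \<Rightarrow> nat set set \<Rightarrow> nat \<Rightarrow> bool" where
  "colorable n G k \<longleftrightarrow>
     (\<exists>f :: nat \<Rightarrow> nat. f ` {1..n} \<subseteq> {..<k} \<and>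
        (\<forall>u\<in>{1..n}. \<forall>v\<in>{1..n}. {u, v} \<in> G \<longrightarrow> f u \<noteq> f v))"

definition chromatic_number :: "nat \<Rightarrow> nat set set \<Rightarrow> nat" where
  "chromatic_number n G = (LEAST k. colorable n G k)"

definition chi_gt :: "nat \<Rightarrow> nat \<Rightarrow> nat set set \<Rightarrow> bool" where
  "chi_gt n k G \<longleftrightarrow> chromatic_number n G \<ge> k + 1"

definition legal_edges :: "nat \<Rightarrow> (nat set set \<Rightarrow> bool) \<Rightarrow> nat set set \<Rightarrow> nat set set" where
  "legal_edges n P G = {e \<in> all_edges n - G. \<not> P (insert e G)}"

lemma finite_legal_edges [simp]: "finite (legal_edges n P G)"
  by (rule finite_subset [OF _ finite_all_edges [of n]]) (auto simp: legal_edges_def)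

datatype player = Mini | Maxi

text \<open>Backward induction: the number of edges of the final graph under optimal play from
  the position with current graph \<open>G\<close> and the given player to move.\<close>

function game_value :: "nat \<Rightarrow> (nat set set \<Rightarrow> bool) \<Rightarrow> player \<Rightarrow> nat set set \<Rightarrow> nat" where
  "game_value n P p G =
     (if legal_edges n P G = {} then card G
      else case p of
          Mini \<Rightarrow> Min ((\<lambda>e. game_value n P Maxi (insert e G)) ` legal_edges n P G)
        | Maxi \<Rightarrow> Max ((\<lambda>e. game_value n P Mini (insert e G)) ` legal_edges n P G))"
  by pat_completeness auto
termination
  by (relation "measure (\<lambda>(n, P, p, G). card (all_edges n - G))")
     (auto simp: legal_edges_def card_gt_0_iff intro!: diff_less)

declare game_value.simps [simp del]

definition score :: "nat \<Rightarrow> (nat set set \<Rightarrow> bool) \<Rightarrow> player \<Rightarrow> nat" where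
  "score n P first = game_value n P first {}"

lemma colorable_mono_colors: "colorable n G k \<Longrightarrow> k \<le> m \<Longrightarrow> colorable n G m"
  unfolding colorable_def by (meson lessThan_subset_iff order_trans)

lemma colorable_n:
  assumes "G \<subseteq> all_edges n"
  shows "colorable n G n"
proof -
  have "u \<noteq> v" if "{u, v} \<in> G" for u v
    using that assms by (auto simp: all_edges_def)
  then show ?thesis
    unfolding colorable_def by (intro exI [of _ "\<lambda>v. v - 1"]) force
qed

lemma chi_gt_iff:
  assumes "G \<subseteq> all_edges n"
  shows "chi_gt n k G \<longleftrightarrow> \<not> colorable n G k"
proof -
  have "colorable n G (chromatic_number n G)"
    unfolding chromatic_number_def by (rule LeastI) (rule colorable_n [OF assms])
  then have "chromatic_number n G \<le> k \<longleftrightarrow> colorable n G k"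
    using colorable_mono_colors unfolding chromatic_number_def by (blast intro: Least_le)
  then show ?thesis
    by (auto simp: chi_gt_def)
qed

lemma chi_gt_mono:
  assumes "chi_gt n k G" "G \<subseteq> H" "H \<subseteq> all_edges n"
  shows "chi_gt n k H"
proof -
  have "G \<subseteq> all_edges n" using assms by blast
  then show ?thesis
    using assms(1,2) chi_gt_iff [OF assms(3)] by (auto simp: chi_gt_iff colorable_def) blast
qed

text \<open>For $k = 1$ no edge is ever legal, so the game ends with the empty graph, while
  $1 - C \log k / k = 1$ there. Hence the lower bound can only be claimed for $k \ge 2$.\<close>

lemma score_chi_gt_1: "score n (chi_gt n 1) first = 0"
proof -
  have "legal_edges n (chi_gt n 1) {} = {}"
  proof -
    have "chi_gt n 1 {e}" if e: "e \<in> all_edges n" for e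
    proof -
      obtain u v where uv: "e = {u, v}" "u \<noteq> v"
        using e by (auto simp: all_edges_def card_2_iff)
      have "u \<in> {1..n}" "v \<in> {1..n}"
        using e uv by (auto simp: all_edges_def)
      then have "\<not> colorable n {e} 1"
        unfolding colorable_def uv(1) by (fastforce simp: image_subset_iff)
      then show ?thesis
        using e by (subst chi_gt_iff) auto
    qed
    then show ?thesis by (auto simp: legal_edges_def)
  qed
  then show ?thesis
    by (simp add: score_def game_value.simps)
qed

end

theory Submission imports Defs begin

text \<open>
  The final graph is complete \<open>k\<close>-partite, so it suffices that Max keeps every set of
  \<open>a = O(n log k / k)\<close> vertices from being independent at the end. An edge at a vertex of degree
  at most \<open>k - 2\<close> is always legal. Max therefore answers an edge of Mini by an edge from one of its
  low-degree endpoints to a random vertex: every vertex whose degree reaches \<open>k - 1\<close> has by then,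
  with few exceptions, sent out \<open>D = \<Omega>(k)\<close> random edges, and so a fixed independent
  \<open>a\<close>-set survives with probability at most about \<open>exp (- a\<^sup>2 D / (2 n))\<close>, which beats
  the number of such sets. The random choice is derandomised by a potential function, the sum of
  the (conditional) expected number of surviving independent sets and of exceptional vertices.
\<close>

section \<open>Degrees and colourability\<close>

definition degree :: "nat set set \<Rightarrow> nat \<Rightarrow> nat" where
  "degree G v = card {e \<in> G. v \<in> e}"

lemma finite_subset_all_edges: "G \<subseteq> all_edges n \<Longrightarrow> finite G"
  using finite_subset finite_all_edges by blast

lemma doubleton_in_all_edges: "{u, v} \<in> all_edges n \<longleftrightarrow> u \<in> {1..n} \<and> v \<in> {1..n} \<and> u \<noteq> v"
  by (auto simp: all_edges_def card_2_iff')

lemma degree_insert_le: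
  assumes "finite G"
  shows "degree (insert e G) v \<le> degree G v + (if v \<in> e then 1 else 0)"
proof -
  have "{e' \<in> insert e G. v \<in> e'} = (if v \<in> e then insert e {e \<in> G. v \<in> e} else {e \<in> G. v \<in> e})"
    by auto
  then show ?thesis
    using assms by (simp add: degree_def card_insert_if)
qed

lemma card_neighbours_le_degree:
  assumes "finite G"
  shows "card {u. {v, u} \<in> G} \<le> degree G v" "finite {u. {v, u} \<in> G}"
proof -
  have inj: "inj_on (\<lambda>u. {v, u}) {u. {v, u} \<in> G}"
    by (auto simp: inj_on_def doubleton_eq_iff)
  have sub: "(\<lambda>u. {v, u}) ` {u. {v, u} \<in> G} \<subseteq> {e \<in> G. v \<in> e}"
    by auto
  show "card {u. {v, u} \<in> G} \<le> degree G v"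
    unfolding degree_def using assms by (intro card_inj_on_le [OF inj sub]) auto
  show "finite {u. {v, u} \<in> G}"
    using inj_on_finite [OF inj sub] assms by auto
qed

lemma sum_degree:
  assumes "G \<subseteq> all_edges n"
  shows "(\<Sum>v\<in>{1..n}. degree G v) = 2 * card G"
proof -
  have "(\<Sum>v\<in>{1..n}. card {e \<in> G. v \<in> e}) = 2 * card G"
  proof (rule sum_multicount)
    show "\<forall>e\<in>G. card {v \<in> {1..n}. v \<in> e} = 2"
    proof
      fix e assume "e \<in> G"
      then have "e \<subseteq> {1..n}" "card e = 2"
        using assms by (auto simp: all_edges_def)
      moreover from this have "{v \<in> {1..n}. v \<in> e} = e" by auto
      ultimately show "card {v \<in> {1..n}. v \<in> e} = 2" by simp
    qed
  qed (use assms finite_subset_all_edges in auto)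
  then show ?thesis by (simp add: degree_def)
qed

text \<open>Recolour \<open>v\<close> alone: \<open>w\<close> and the neighbours of \<open>v\<close>
  carry at most \<open>degree G v + 1 < k\<close> colours, so one colour is free for
  \<open>v\<close>.\<close>

lemma colorable_insert_low_degree:
  assumes "G \<subseteq> all_edges n" "colorable n G k" "v \<noteq> w" "degree G v + 2 \<le> k"
  shows "colorable n (insert {v, w} G) k"
proof -
  obtain f where f: "f ` {1..n} \<subseteq> {..<k}"
      "\<forall>u\<in>{1..n}. \<forall>v\<in>{1..n}. {u, v} \<in> G \<longrightarrow> f u \<noteq> f v"
    using assms(2) unfolding colorable_def by auto
  define U where "U = insert w {u. {v, u} \<in> G}"
  have fin: "finite G" using assms(1) by (rule finite_subset_all_edges)
  have finU: "finite U"
    unfolding U_def using card_neighbours_le_degree [OF fin] by auto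
  have "card U \<le> degree G v + 1"
    unfolding U_def using card_neighbours_le_degree [OF fin, of v]
    by (simp add: card_insert_if)
  then have "card (f ` U) < card {..<k}"
    using card_image_le [OF finU, of f] assms(4) by simp
  then obtain c where c: "c < k" "c \<notin> f ` U"
    using finU by (metis card_mono finite_imageI lessThan_iff not_less subsetI)
  have vU: "v \<notin> U"
    using assms(1,3) doubleton_in_all_edges [of v v n] by (auto simp: U_def)
  show ?thesis
    unfolding colorable_def
  proof (intro exI [of _ "f(v := c)"] conjI ballI impI)
    show "(f(v := c)) ` {1..n} \<subseteq> {..<k}"
      using f(1) c by auto
    fix x y assume xy: "x \<in> {1..n}" "y \<in> {1..n}" "{x, y} \<in> insert {v, w} G"
    have "y \<in> U" if "x = v"
      using xy that by (auto simp: U_def doubleton_eq_iff)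
    moreover have "x \<in> U" if "y = v"
      using xy that by (auto simp: U_def doubleton_eq_iff insert_commute)
    moreover have "{x, y} \<in> G" if "x \<noteq> v" "y \<noteq> v"
      using xy that by (auto simp: doubleton_eq_iff)
    ultimately show "(f(v := c)) x \<noteq> (f(v := c)) y"
      using c f(2) vU xy by auto
  qed
qed

lemma legal_edges_chi_gt:
  assumes "G \<subseteq> all_edges n"
  shows "e \<in> legal_edges n (chi_gt n k) G \<longleftrightarrow> e \<in> all_edges n - G \<and> colorable n (insert e G) k"
  using assms by (auto simp: legal_edges_def chi_gt_iff)

section \<open>Bounding the game value by an invariant\<close>

lemma game_value_terminal: "legal_edges n P G = {} \<Longrightarrow> game_value n P p G = card G"
  by (simp add: game_value.simps)

lemma game_value_Maxi_ge:
  assumes "e \<in> legal_edges n P G"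
  shows "game_value n P Maxi G \<ge> game_value n P Mini (insert e G)"
  using assms by (subst game_value.simps) (auto intro!: Max_ge)

lemma game_value_Mini_ge:
  assumes "legal_edges n P G \<noteq> {}"
    and "\<And>e. e \<in> legal_edges n P G \<Longrightarrow> game_value n P Maxi (insert e G) \<ge> t"
  shows "game_value n P Mini G \<ge> t"
  using assms by (subst game_value.simps) auto

text \<open>\<open>I\<close> describes the positions that Max hands to Mini, so the induction runs
  over rounds of two moves. The game may stop right after an edge of Mini, before \<open>I\<close>
  is restored; \<open>terminal'\<close> covers that case.\<close>

lemma game_value_ge_invariant:
  assumes terminal: "\<And>G. I G \<Longrightarrow> legal_edges n P G = {} \<Longrightarrow> t \<le> card G"
    and terminal': "\<And>G e. I G \<Longrightarrow> e \<in> legal_edges n P G \<Longrightarrow>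
          legal_edges n P (insert e G) = {} \<Longrightarrow> t \<le> card (insert e G)"
    and step: "\<And>G e. I G \<Longrightarrow> e \<in> legal_edges n P G \<Longrightarrow> legal_edges n P (insert e G) \<noteq> {} \<Longrightarrow>
          \<exists>e' \<in> legal_edges n P (insert e G). I (insert e' (insert e G))"
    and "I G"
  shows "t \<le> game_value n P Mini G"
  using \<open>I G\<close>
proof (induction "card (all_edges n - G)" arbitrary: G rule: less_induct)
  case (less G)
  show ?case
  proof (cases "legal_edges n P G = {}")
    case True
    then show ?thesis using terminal less.prems by (simp add: game_value_terminal)
  next
    case False
    then show ?thesis
    proof (rule game_value_Mini_ge)
      fix e assume e: "e \<in> legal_edges n P G"
      show "t \<le> game_value n P Maxi (insert e G)"
      proof (cases "legal_edges n P (insert e G) = {}")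
        case True
        then show ?thesis using terminal' less.prems e by (simp add: game_value_terminal)
      next
        case False
        then obtain e' where e': "e' \<in> legal_edges n P (insert e G)" "I (insert e' (insert e G))"
          using step less.prems e by blast
        have "all_edges n - insert e' (insert e G) \<subset> all_edges n - G"
          using e by (auto simp: legal_edges_def)
        then have "card (all_edges n - insert e' (insert e G)) < card (all_edges n - G)"
          by (intro psubset_card_mono) auto
        from less.hyps [OF this e'(2)] show ?thesis
          using game_value_Maxi_ge [OF e'(1)] by simp
      qed
    qed
  qed
qed

section \<open>Finite sums and averages\<close>

lemma sum_eq_outside:
  fixes f g :: "'a \<Rightarrow> 'b::ab_group_add"
  assumes "finite S" "B \<subseteq> S" "\<And>u. u \<in> S - B \<Longrightarrow> f u = g u"
  shows "sum f S = sum g S + (sum f B - sum g B)"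
proof -
  have "sum f (S - B) = sum g (S - B)"
    using assms(3) by (rule sum.cong [OF refl])
  then show ?thesis
    using sum.subset_diff [OF assms(2,1), of f] sum.subset_diff [OF assms(2,1), of g] by simp
qed

lemma sum_fun_upd_Suc:
  fixes f :: "'a \<Rightarrow> nat"
  assumes "finite S" "v \<in> S"
  shows "sum (f(v := Suc (f v))) S = Suc (sum f S)"
  using assms by (simp add: sum.remove [of S v])

lemma exists_le_average:
  fixes f :: "'a \<Rightarrow> real" and c :: real
  assumes "finite N" "N \<noteq> {}" "(\<Sum>w\<in>N. f w) \<le> card N * c"
  shows "\<exists>w\<in>N. f w \<le> c"
proof (rule ccontr)
  assume "\<not> ?thesis"
  then have "(\<Sum>w\<in>N. c) < (\<Sum>w\<in>N. f w)"
    using assms by (intro sum_strict_mono) auto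
  then show False using assms(3) by simp
qed

lemma card_weight_le:
  fixes f :: "'a \<Rightarrow> real" and c :: real
  assumes "finite S" "\<And>v. v \<in> S \<Longrightarrow> 0 \<le> f v" "B \<subseteq> S" "\<And>v. v \<in> B \<Longrightarrow> c \<le> f v"
  shows "card B * c \<le> sum f S"
proof -
  have "card B * c \<le> sum f B"
    using sum_bounded_below [of B c f] assms(4) by simp
  also have "\<dots> \<le> sum f S"
    using assms by (intro sum_mono2) auto
  finally show ?thesis .
qed

section \<open>Counters, potential function and invariant\<close>

text \<open>A vertex whose counters total \<open>K = D + 2 * T\<close> although \<open>out\<close>
  is below \<open>D\<close> has \<open>mini\<close> or \<open>inn\<close> at least \<open>T\<close>;
  such vertices are the exceptional ones. By \<open>K + 2 \<le> k\<close> a new edge at a vertex of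
  degree at most \<open>K\<close> is legal, and by \<open>2 * (K + 1) \<le> n\<close> such a vertex
  has at least \<open>n / 2\<close> non-neighbours.\<close>

locale colouring_game =
  fixes n k D T K a :: nat
  assumes K_def: "K = D + 2 * T" and K_le: "K + 2 \<le> k" and n_ge: "2 * (K + 1) \<le> n"
    and a_ge: "2 \<le> a" and a_le: "a \<le> n" and D_pos: "0 < D"
begin

text \<open>A random edge sent out by a vertex of an independent \<open>a\<close>-set destroys that set with
  probability at least \<open>hit\<close>.\<close>

definition hit :: real where "hit = real (a - 1) / real n"

definition indep :: "nat set set \<Rightarrow> nat set set" where
  "indep G = {A. A \<subseteq> {1..n} \<and> card A = a \<and> (\<forall>u\<in>A. \<forall>v\<in>A. {u, v} \<notin> G)}"

text \<open>A set \<open>A\<close> survives a random edge sent out by one of its vertices with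
  probability at most \<open>exp (- hit)\<close>, and its weight then gains the factor
  \<open>exp hit\<close>, so the expected sum does not grow.\<close>

definition pot_indep :: "nat set set \<Rightarrow> (nat \<Rightarrow> nat) \<Rightarrow> real" where
  "pot_indep G out = (\<Sum>A\<in>indep G. exp (hit * real (\<Sum>v\<in>A. out v)))"

text \<open>Below, \<open>out v\<close> counts the edges Max has sent out from \<open>v\<close>, \<open>inn v\<close> the edges Max has sent
  into \<open>v\<close>, and \<open>mini v\<close> the edges of Mini at \<open>v\<close> while \<open>v\<close> was active. The constants satisfy
  \<open>3/2 * (1 + 1/3) = 2\<close>: an edge of Mini multiplies two summands by \<open>3/2\<close>, and the reply multiplies
  the larger one by \<open>1/3\<close>.\<close>

definition pot_mini :: "(nat \<Rightarrow> nat) \<Rightarrow> (nat \<Rightarrow> nat) \<Rightarrow> real" where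
  "pot_mini out mini = (\<Sum>v\<in>{1..n}. (3/2) ^ mini v * (1/3) ^ out v)"

text \<open>Each edge sent out raises the expected value of the sum by a factor of at most
  \<open>exp (2 / n)\<close>, for which the first factor compensates; since \<open>out \<le> D\<close> it never drops below 1.\<close>

definition pot_in :: "(nat \<Rightarrow> nat) \<Rightarrow> (nat \<Rightarrow> nat) \<Rightarrow> real" where
  "pot_in out inn = exp (2 * D - 2 / n * real (\<Sum>v\<in>{1..n}. out v)) * (\<Sum>v\<in>{1..n}. 2 ^ inn v)"

text \<open>The coefficients are such that, while \<open>out\<close> is bounded by \<open>D\<close>,
  some term reaches 1 if an independent \<open>a\<close>-set has sent out \<open>D * a / 2\<close>
  edges or if there are \<open>a / 4\<close> exceptional vertices of one kind.\<close>

definition pot :: "nat set set \<Rightarrow> (nat \<Rightarrow> nat) \<Rightarrow> (nat \<Rightarrow> nat) \<Rightarrow> (nat \<Rightarrow> nat) \<Rightarrow> real" where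
  "pot G out mini inn = exp (- hit * D * a / 2) * pot_indep G out
     + 4 / (a * (3/2) ^ T * (1/3) ^ D) * pot_mini out mini
     + 4 / (a * 2 ^ T) * pot_in out inn"

text \<open>Max has no more interest in a vertex that is not active: either it has sent out enough edges,
  or it is exceptional.\<close>

definition active :: "(nat \<Rightarrow> nat) \<Rightarrow> (nat \<Rightarrow> nat) \<Rightarrow> (nat \<Rightarrow> nat) \<Rightarrow> nat \<Rightarrow> bool" where
  "active out mini inn v \<longleftrightarrow> v \<in> {1..n} \<and> out v < D \<and> out v + mini v + inn v < K"

text \<open>Counters never decrease during play, so an inactive vertex stays inactive and its degree
  needs no control.\<close>

definition inv :: "nat set set \<Rightarrow> (nat \<Rightarrow> nat) \<Rightarrow> (nat \<Rightarrow> nat) \<Rightarrow> (nat \<Rightarrow> nat) \<Rightarrow> bool" where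
  "inv G out mini inn \<longleftrightarrow> G \<subseteq> all_edges n \<and> colorable n G k \<and> pot G out mini inn < 1 \<and>
     (\<forall>v\<in>{1..n}. out v \<le> D) \<and>
     (\<forall>v. active out mini inn v \<longrightarrow> degree G v \<le> out v + mini v + inn v)"

lemma n_pos: "0 < n" using n_ge by auto

lemma hit_nonneg: "0 \<le> hit" by (simp add: hit_def)

lemma finite_indep [simp]: "finite (indep G)"
  by (rule finite_subset [of _ "Pow {1..n}"]) (auto simp: indep_def)

lemma indep_antimono: "G \<subseteq> H \<Longrightarrow> indep H \<subseteq> indep G"
  by (auto simp: indep_def)

lemma pot_indep_antimono: "G \<subseteq> H \<Longrightarrow> pot_indep H out \<le> pot_indep G out"
  unfolding pot_indep_def by (intro sum_mono2) (auto simp: indep_antimono)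

lemma indep_insert:
  assumes "v \<noteq> w"
  shows "indep (insert {v, w} G) = {A \<in> indep G. \<not> (v \<in> A \<and> w \<in> A)}"
  using assms by (auto simp: indep_def doubleton_eq_iff)

section \<open>Averaging the potential over a random edge from a vertex\<close>

definition non_nbrs :: "nat set set \<Rightarrow> nat \<Rightarrow> nat set" where
  "non_nbrs G v = {w \<in> {1..n}. w \<noteq> v \<and> {v, w} \<notin> G}"

lemma card_non_nbrs:
  assumes "G \<subseteq> all_edges n" "degree G v \<le> K"
  shows "real n / 2 \<le> card (non_nbrs G v)" "card (non_nbrs G v) \<le> n" "finite (non_nbrs G v)"
proof -
  have fin: "finite G" using assms(1) by (rule finite_subset_all_edges)
  show "finite (non_nbrs G v)" by (simp add: non_nbrs_def)
  have "card (non_nbrs G v) \<le> card {1..n}"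
    by (intro card_mono) (auto simp: non_nbrs_def)
  then show "card (non_nbrs G v) \<le> n" by simp
  have "card {1..n} \<le> card (non_nbrs G v \<union> insert v {u. {v, u} \<in> G})"
    using card_neighbours_le_degree [OF fin] by (intro card_mono) (auto simp: non_nbrs_def)
  also have "\<dots> \<le> card (non_nbrs G v) + card (insert v {u. {v, u} \<in> G})"
    by (rule card_Un_le)
  also have "\<dots> \<le> card (non_nbrs G v) + (degree G v + 1)"
    using card_neighbours_le_degree [OF fin, of v] by (simp add: card_insert_if)
  finally show "real n / 2 \<le> card (non_nbrs G v)"
    using n_ge assms(2) by simp
qed

text \<open>If \<open>v\<close> is in \<open>A\<close>, the other \<open>a - 1\<close> vertices of
  \<open>A\<close> are non-neighbours of \<open>v\<close>, and there are at most \<open>n\<close>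
  non-neighbours. So a random \<open>w\<close> spares \<open>A\<close> with probability at most
  \<open>1 - hit \<le> exp (- hit)\<close>, which cancels the gain in weight.\<close>

lemma sum_pot_indep_le:
  assumes G: "G \<subseteq> all_edges n" and deg: "degree G v \<le> K"
  shows "(\<Sum>w\<in>non_nbrs G v. pot_indep (insert {v, w} G) (out(v := Suc (out v))))
           \<le> card (non_nbrs G v) * pot_indep G out"
proof -
  let ?N = "non_nbrs G v" and ?o = "out(v := Suc (out v))"
  define W where "W A = exp (hit * real (\<Sum>u\<in>A. ?o u))" for A
  note N = card_non_nbrs [OF G deg]
  have "(\<Sum>w\<in>?N. pot_indep (insert {v, w} G) ?o) =
        (\<Sum>w\<in>?N. \<Sum>A\<in>indep G. if v \<in> A \<and> w \<in> A then 0 else W A)"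
  proof (rule sum.cong [OF refl])
    fix w assume "w \<in> ?N"
    then have "v \<noteq> w" by (auto simp: non_nbrs_def)
    then show "pot_indep (insert {v, w} G) ?o = (\<Sum>A\<in>indep G. if v \<in> A \<and> w \<in> A then 0 else W A)"
      unfolding pot_indep_def W_def [symmetric]
      by (subst indep_insert) (auto simp: sum.inter_filter intro!: sum.cong)
  qed
  also have "\<dots> = (\<Sum>A\<in>indep G. \<Sum>w\<in>?N. if v \<in> A \<and> w \<in> A then 0 else W A)"
    by (rule sum.swap)
  also have "\<dots> \<le> (\<Sum>A\<in>indep G. card ?N * exp (hit * real (\<Sum>u\<in>A. out u)))"
  proof (rule sum_mono)
    fix A assume A: "A \<in> indep G"
    then have A': "A \<subseteq> {1..n}" "card A = a" "\<forall>u\<in>A. \<forall>v\<in>A. {u, v} \<notin> G"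
      by (auto simp: indep_def)
    have finA: "finite A" using A'(1) finite_subset by blast
    show "(\<Sum>w\<in>?N. if v \<in> A \<and> w \<in> A then 0 else W A) \<le> card ?N * exp (hit * real (\<Sum>u\<in>A. out u))"
    proof (cases "v \<in> A")
      case False
      then have "(\<Sum>u\<in>A. ?o u) = (\<Sum>u\<in>A. out u)" by (intro sum.cong) auto
      then show ?thesis using False by (simp add: W_def)
    next
      case True
      have sub: "A - {v} \<subseteq> ?N" using A' True by (auto simp: non_nbrs_def)
      have eq: "?N - A = ?N - (A - {v})" by (auto simp: non_nbrs_def)
      have cardNA: "card (?N - A) = card ?N - (a - 1)" "a - 1 \<le> card ?N"
        using card_mono [OF N(3) sub] finA True A'(2) card_Diff_subset [OF _ sub] 
        by (auto simp: eq)
      have "(\<Sum>w\<in>?N. if v \<in> A \<and> w \<in> A then 0 else W A) = (\<Sum>w\<in>?N - A. W A)"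
        using True N(3) by (intro sum.mono_neutral_cong_right) auto
      also have "\<dots> = (real (card ?N) - real (a - 1)) * W A"
        using cardNA by simp
      also have "\<dots> = (real (card ?N) - real (a - 1)) * (exp hit * exp (hit * real (\<Sum>u\<in>A. out u)))"
        unfolding W_def sum_fun_upd_Suc [OF finA True]
        by (simp add: exp_add [symmetric] algebra_simps)
      also have "\<dots> \<le> card ?N * exp (hit * real (\<Sum>u\<in>A. out u))"
      proof -
        have "hit * card ?N \<le> hit * n" using N(2) hit_nonneg by (intro mult_left_mono) auto
        also have "\<dots> = real (a - 1)" using n_pos by (simp add: hit_def)
        finally have "real (card ?N) - real (a - 1) \<le> card ?N * (1 - hit)" by (simp add: algebra_simps)
        also have "\<dots> \<le> card ?N * exp (- hit)"
          using exp_ge_add_one_self [of "- hit"] by (intro mult_left_mono) auto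
        finally have "(real (card ?N) - real (a - 1)) * exp hit \<le> card ?N * exp (- hit) * exp hit"
          by (intro mult_right_mono) auto
        then have "(real (card ?N) - real (a - 1)) * exp hit \<le> card ?N"
          by (simp add: mult.assoc exp_add [symmetric])
        then show ?thesis by (simp add: mult.assoc [symmetric] mult_right_mono)
      qed
      finally show ?thesis .
    qed
  qed
  also have "\<dots> = card ?N * pot_indep G out"
    by (simp add: pot_indep_def sum_distrib_left)
  finally show ?thesis .
qed

text \<open>At least \<open>n / 2\<close> endpoints are available, so each vertex is chosen with
  probability at most \<open>2 / n\<close>, and its summand then doubles. The expected sum grows by
  a factor of at most \<open>1 + 2 / n \<le> exp (2 / n)\<close>, which the prefactor loses.\<close>

lemma sum_pot_in_le:
  assumes G: "G \<subseteq> all_edges n" and v: "v \<in> {1..n}" and deg: "degree G v \<le> K"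
  shows "(\<Sum>w\<in>non_nbrs G v. pot_in (out(v := Suc (out v))) (inn(w := Suc (inn w))))
           \<le> card (non_nbrs G v) * pot_in out inn"
proof -
  let ?N = "non_nbrs G v" and ?S = "\<Sum>u\<in>{1..n}. 2 ^ inn u :: real"
  note N = card_non_nbrs [OF G deg]
  have S: "(\<Sum>u\<in>{1..n}. 2 ^ (inn(w := Suc (inn w))) u :: real) = ?S + 2 ^ inn w" if "w \<in> ?N" for w
  proof -
    have "{w} \<subseteq> {1..n}" using that by (auto simp: non_nbrs_def)
    then show ?thesis by (subst sum_eq_outside [where B = "{w}" and g = "\<lambda>u. 2 ^ inn u"]) auto
  qed
  have "(\<Sum>u\<in>{1..n}. (out(v := Suc (out v))) u) = Suc (\<Sum>u\<in>{1..n}. out u)"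
    using v by (intro sum_fun_upd_Suc) auto
  then have out: "exp (2 * D - 2 / n * real (\<Sum>u\<in>{1..n}. (out(v := Suc (out v))) u))
       = exp (2 * D - 2 / n * real (\<Sum>u\<in>{1..n}. out u)) * exp (- (2 / n))" (is "_ = ?E * _")
    by (simp add: exp_add [symmetric] algebra_simps add_divide_distrib)
  have "(\<Sum>w\<in>?N. ?S + 2 ^ inn w) \<le> card ?N * (?S * exp (2 / n))"
  proof -
    have "(\<Sum>w\<in>?N. ?S + 2 ^ inn w) = card ?N * ?S + (\<Sum>w\<in>?N. 2 ^ inn w)"
      by (simp add: sum.distrib)
    also have "(\<Sum>w\<in>?N. 2 ^ inn w) \<le> card ?N * (?S * (2 / n))"
    proof -
      have "(\<Sum>w\<in>?N. 2 ^ inn w) \<le> ?S"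
        by (intro sum_mono2) (auto simp: non_nbrs_def)
      also have "\<dots> = ?S * 1" by simp
      also have "\<dots> \<le> ?S * (card ?N * (2 / n))"
        using N(1) n_pos by (intro mult_left_mono sum_nonneg) (auto simp: field_simps)
      finally show ?thesis by (simp only: mult_ac mult_1_right)
    qed
    also have "card ?N * ?S + card ?N * (?S * (2 / n)) = card ?N * (?S * (1 + 2 / n))"
      by (simp add: algebra_simps)
    also have "\<dots> \<le> card ?N * (?S * exp (2 / n))"
      by (intro mult_left_mono sum_nonneg exp_ge_add_one_self) auto
    finally show ?thesis by linarith
  qed
  then have "?E * exp (- (2 / n)) * (\<Sum>w\<in>?N. ?S + 2 ^ inn w)
      \<le> ?E * exp (- (2 / n)) * (card ?N * (?S * exp (2 / n)))"
    by (intro mult_left_mono) auto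
  also have "\<dots> = card ?N * (?E * ?S) * (exp (- (2 / n)) * exp (2 / n))"
    by (simp only: mult_ac)
  also have "\<dots> = card ?N * (?E * ?S)"
    by (simp add: exp_add [symmetric])
  finally have le: "?E * exp (- (2 / n)) * (\<Sum>w\<in>?N. ?S + 2 ^ inn w) \<le> card ?N * (?E * ?S)" .
  have eq: "(\<Sum>w\<in>?N. \<Sum>u\<in>{1..n}. 2 ^ (inn(w := Suc (inn w))) u :: real) = (\<Sum>w\<in>?N. ?S + 2 ^ inn w)"
    by (rule sum.cong [OF refl S])
  show ?thesis
    unfolding pot_in_def out sum_distrib_left [symmetric] eq by (rule le)
qed

text \<open>The two parts that depend on \<open>w\<close> are averaged together, so that a single
  \<open>w\<close> serves both; \<open>pot_mini\<close> does not depend on \<open>w\<close>.\<close>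

lemma exists_good_nbr:
  assumes G: "G \<subseteq> all_edges n" and v: "v \<in> {1..n}" and deg: "degree G v \<le> K"
    and mini: "pot_mini (out(v := Suc (out v))) mini' \<le> pot_mini out mini"
  obtains w where "w \<in> {1..n}" "w \<noteq> v" "{v, w} \<notin> G"
    "pot (insert {v, w} G) (out(v := Suc (out v))) mini' (inn(w := Suc (inn w))) \<le> pot G out mini inn"
proof -
  let ?N = "non_nbrs G v" and ?o = "out(v := Suc (out v))"
  define c1 c2 where "c1 = exp (- hit * D * a / 2)" and "c2 = 4 / (a * 2 ^ T :: real)"
  have c: "c1 \<ge> 0" "c2 \<ge> 0" by (auto simp: c1_def c2_def)
  note N = card_non_nbrs [OF G deg]
  have "(\<Sum>w\<in>?N. c1 * pot_indep (insert {v, w} G) ?o + c2 * pot_in ?o (inn(w := Suc (inn w))))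
     \<le> c1 * (card ?N * pot_indep G out) + c2 * (card ?N * pot_in out inn)"
    using c sum_pot_indep_le [OF G deg] sum_pot_in_le [OF G v deg]
    by (auto simp: sum.distrib sum_distrib_left [symmetric] intro!: add_mono mult_left_mono)
  also have "\<dots> = card ?N * (c1 * pot_indep G out + c2 * pot_in out inn)"
    by (simp add: algebra_simps)
  finally have "\<exists>w\<in>?N. c1 * pot_indep (insert {v, w} G) ?o + c2 * pot_in ?o (inn(w := Suc (inn w)))
       \<le> c1 * pot_indep G out + c2 * pot_in out inn"
    using N n_pos by (intro exists_le_average) auto
  then obtain w where w: "w \<in> ?N" "c1 * pot_indep (insert {v, w} G) ?o + c2 * pot_in ?o (inn(w := Suc (inn w)))
       \<le> c1 * pot_indep G out + c2 * pot_in out inn" by blast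
  have "4 / (a * (3/2) ^ T * (1/3) ^ D) * pot_mini ?o mini'
      \<le> 4 / (a * (3/2) ^ T * (1/3) ^ D) * pot_mini out mini"
    using mini by (intro mult_left_mono) auto
  then have "pot (insert {v, w} G) ?o mini' (inn(w := Suc (inn w))) \<le> pot G out mini inn"
    using w(2) unfolding pot_def c1_def [symmetric] c2_def [symmetric] by linarith
  then show ?thesis using that w(1) by (auto simp: non_nbrs_def)
qed

section \<open>Replies of Max that keep the invariant\<close>

text \<open>The edges of Mini are already credited in \<open>mini'\<close>, so the lemma covers an
  answer to Mini as well as an opening move of Max.\<close>

lemma Max_reply:
  assumes G: "G \<subseteq> all_edges n" "colorable n G k"
    and pot: "pot G out mini inn < 1"
    and out: "\<forall>v\<in>{1..n}. out v \<le> D"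
    and v: "v \<in> {1..n}" "degree G v \<le> K" "out v < D"
    and mini: "pot_mini (out(v := Suc (out v))) mini' \<le> pot_mini out mini"
    and deg: "\<And>u. active out mini' inn u \<Longrightarrow> degree G u \<le> out u + mini' u + inn u"
  shows "\<exists>e\<in>legal_edges n (chi_gt n k) G. \<exists>out inn. inv (insert e G) out mini' inn"
proof -
  obtain w where w: "w \<in> {1..n}" "w \<noteq> v" "{v, w} \<notin> G"
    "pot (insert {v, w} G) (out(v := Suc (out v))) mini' (inn(w := Suc (inn w))) \<le> pot G out mini inn"
    using exists_good_nbr [OF G(1) v(1,2) mini] by blast
  let ?o = "out(v := Suc (out v))" and ?i = "inn(w := Suc (inn w))"
  have col: "colorable n (insert {v, w} G) k"
    using w v K_le G by (intro colorable_insert_low_degree) auto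
  have edge: "{v, w} \<in> all_edges n"
    using v w by (simp add: doubleton_in_all_edges)
  \<comment> \<open>The new edge raises only the degrees of \<open>v\<close> and \<open>w\<close>,
    and \<open>out v\<close> and \<open>inn w\<close> rise with them.\<close>
  have "degree (insert {v, w} G) u \<le> ?o u + mini' u + ?i u" if "active ?o mini' ?i u" for u
  proof -
    have "active out mini' inn u"
      using that by (auto simp: active_def split: if_splits)
    from deg [OF this] show ?thesis
      using degree_insert_le [OF finite_subset_all_edges [OF G(1)], of "{v, w}" u] w(2)
      by (auto split: if_splits)
  qed
  then have "inv (insert {v, w} G) ?o mini' ?i"
    using G edge col w(4) pot out v by (auto simp: inv_def)
  moreover have "{v, w} \<in> legal_edges n (chi_gt n k) G"
    using edge col w G by (simp add: legal_edges_chi_gt)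
  ultimately show ?thesis by blast
qed

lemma pot_antimono:
  assumes "G \<subseteq> H"
  shows "pot H out mini inn \<le> pot G out mini inn"
  unfolding pot_def using pot_indep_antimono [OF assms, of out]
  by (intro add_right_mono mult_left_mono) auto

lemma pot_mini_out_le:
  "pot_mini (out(v := Suc (out v))) mini \<le> pot_mini out mini"
  unfolding pot_mini_def by (intro sum_mono) auto

text \<open>With summands \<open>p\<close> at \<open>x\<close> and \<open>q\<close> at
  \<open>y\<close>, the new ones are \<open>3/2 * p\<close> and \<open>1/2 * q\<close>; their sum is
  at most \<open>p + q\<close> because \<open>p \<le> q\<close>.\<close>

lemma pot_mini_reply_le:
  assumes y: "y \<in> {1..n}" and x: "x \<in> {1..n}" "x \<noteq> y"
    and le: "(3/2) ^ mini x * (1/3) ^ out x \<le> ((3/2) ^ mini y * (1/3) ^ out y :: real)"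
  shows "pot_mini (out(y := Suc (out y))) (mini(x := Suc (mini x), y := Suc (mini y))) \<le> pot_mini out mini"
  unfolding pot_mini_def using assms
  by (subst sum_eq_outside [where B = "{x, y}" and g = "\<lambda>v. (3/2) ^ mini v * (1/3) ^ out v"])
     (auto simp: mult.commute)

lemma pot_mini_reply_single_le:
  assumes y: "y \<in> {1..n}"
  shows "pot_mini (out(y := Suc (out y))) (mini(y := Suc (mini y))) \<le> pot_mini out mini"
  unfolding pot_mini_def using assms
  by (subst sum_eq_outside [where B = "{y}" and g = "\<lambda>v. (3/2) ^ mini v * (1/3) ^ out v"]) auto

text \<open>Max answers at the active endpoint of \<open>e\<close> with the larger summand of
  \<open>pot_mini\<close>, failing that at any active vertex, and with any legal edge if no vertex
  is active.\<close>

lemma inv_step: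
  assumes inv: "inv G out mini inn" and e: "e \<in> legal_edges n (chi_gt n k) G"
    and ne: "legal_edges n (chi_gt n k) (insert e G) \<noteq> {}"
  shows "\<exists>e'\<in>legal_edges n (chi_gt n k) (insert e G).
           \<exists>out mini inn. inv (insert e' (insert e G)) out mini inn"
proof -
  let ?G = "insert e G"
  have G: "G \<subseteq> all_edges n" and pot: "pot G out mini inn < 1"
    and out: "\<forall>v\<in>{1..n}. out v \<le> D"
    and deg: "\<And>v. active out mini inn v \<Longrightarrow> degree G v \<le> out v + mini v + inn v"
    using inv by (auto simp: inv_def)
  have e': "e \<in> all_edges n" and col: "colorable n ?G k"
    using e G by (auto simp: legal_edges_chi_gt)
  have G': "?G \<subseteq> all_edges n" using e' G by auto
  have pot': "pot ?G out mini inn < 1"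
    using pot pot_antimono [OF subset_insertI [of G e], of out mini inn] by linarith
  note degree = degree_insert_le [OF finite_subset_all_edges [OF G], of e]
  have reply: ?thesis
    if y: "active out mini inn y"
      and mini: "pot_mini (out(y := Suc (out y))) mini' \<le> pot_mini out mini"
      and mini_ge: "\<And>u. mini u \<le> mini' u"
      and mini_e: "\<And>u. u \<in> e \<Longrightarrow> active out mini inn u \<Longrightarrow> Suc (mini u) \<le> mini' u" for y mini'
  proof -
    \<comment> \<open>Only activity before Mini's edge is available here: the degree was below
      \<open>K\<close>, and \<open>e\<close> adds at most one.\<close>
    have "degree ?G y \<le> K"
      using deg [OF y] degree [of y] y by (auto simp: active_def split: if_splits)
    moreover have "degree ?G u \<le> out u + mini' u + inn u" if u: "active out mini' inn u" for u
    proof -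
      have "active out mini inn u"
        using u mini_ge [of u] by (auto simp: active_def)
      from deg [OF this] mini_e [OF _ this] show ?thesis
        using degree [of u] mini_ge [of u] by (auto split: if_splits)
    qed
    ultimately show ?thesis
      using Max_reply [OF G' col pot' out _ _ _ mini] y by (fastforce simp: active_def)
  qed
  obtain u v where uv: "e = {u, v}" "u \<noteq> v" "u \<in> {1..n}" "v \<in> {1..n}"
    using e' by (auto simp: all_edges_def card_2_iff)
  consider "active out mini inn u" "active out mini inn v"
    | "active out mini inn u" "\<not> active out mini inn v"
    | "\<not> active out mini inn u" "active out mini inn v"
    | x where "\<not> active out mini inn u" "\<not> active out mini inn v" "active out mini inn x"
    | "\<And>x. \<not> active out mini inn x"
    by blast
  then show ?thesis
  proof cases
    case 1
    define W where "W v = (3/2 :: real) ^ mini v * (1/3) ^ out v" for v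
    obtain x y where xy: "e = {x, y}" "x \<noteq> y" "active out mini inn x" "active out mini inn y"
        "W x \<le> W y"
      using 1 uv that [of u v] that [of v u] by (cases "W u \<le> W v") (auto simp: insert_commute)
    then show ?thesis
      by (intro reply [of y "mini(x := Suc (mini x), y := Suc (mini y))"] pot_mini_reply_le)
         (auto simp: W_def active_def)
  next
    case 2
    then show ?thesis
      using uv by (intro reply [of u "mini(u := Suc (mini u))"] pot_mini_reply_single_le) auto
  next
    case 3
    then show ?thesis
      using uv by (intro reply [of v "mini(v := Suc (mini v))"] pot_mini_reply_single_le) auto
  next
    case (4 x)
    then show ?thesis
      using uv by (intro reply [of x mini] pot_mini_out_le) auto
  next
    case 5
    obtain e' where e': "e' \<in> legal_edges n (chi_gt n k) ?G" using ne by blast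
    \<comment> \<open>With the counters unchanged, a further edge can only lower the potential, and
      the degree condition is vacuous.\<close>
    then have "inv (insert e' ?G) out mini inn"
      using G' pot' pot_antimono [OF subset_insertI [of ?G e'], of out mini inn] out 5
      by (auto simp: legal_edges_chi_gt inv_def)
    then show ?thesis using e' by blast
  qed
qed

section \<open>Colour classes and size of the final graph\<close>

text \<open>The last two terms of the potential allow fewer than \<open>a / 4\<close> exceptional
  vertices of each kind. So at least half of \<open>A\<close> has sent out \<open>D\<close> edges,
  and then the summand of \<open>A\<close> alone pushes the first term to 1.\<close>

lemma no_inactive_indep:
  assumes out: "\<forall>v\<in>{1..n}. out v \<le> D" and pot: "pot G out mini inn < 1"
    and A: "A \<in> indep G" and inact: "\<And>v. v \<in> A \<Longrightarrow> \<not> active out mini inn v"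
  shows False
proof -
  have A': "A \<subseteq> {1..n}" "card A = a" "finite A"
    using A finite_subset by (auto simp: indep_def)
  define B1 where "B1 = {v \<in> A. out v < D \<and> T \<le> mini v}"
  define B2 where "B2 = {v \<in> A. out v < D \<and> T \<le> inn v}"
  define B3 where "B3 = {v \<in> A. D \<le> out v}"
  \<comment> \<open>If \<open>out v < D\<close>, the total of at least \<open>D + 2 * T\<close>
    leaves more than \<open>2 * T\<close> for \<open>mini v + inn v\<close>.\<close>
  have "A \<subseteq> B1 \<union> (B2 \<union> B3)"
    using inact A'(1) K_def unfolding B1_def B2_def B3_def active_def by force
  then have "card A \<le> card (B1 \<union> (B2 \<union> B3))"
    using A'(3) by (intro card_mono) (auto simp: B1_def B2_def B3_def)
  also have "\<dots> \<le> card B1 + (card B2 + card B3)"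
    by (meson card_Un_le le_trans add_left_mono)
  finally have cards: "a \<le> card B1 + (card B2 + card B3)" using A'(2) by simp
  define w1 w2 w3 where
    "w1 = exp (- hit * D * a / 2) * pot_indep G out" and
    "w2 = 4 / (a * (3/2) ^ T * (1/3) ^ D) * pot_mini out mini" and
    "w3 = 4 / (a * 2 ^ T) * pot_in out inn"
  have nonneg: "0 \<le> w1" "0 \<le> w2" "0 \<le> w3"
    unfolding w1_def w2_def w3_def pot_indep_def pot_mini_def pot_in_def
    by (intro mult_nonneg_nonneg sum_nonneg; simp)+
  have sum: "w1 + w2 + w3 < 1"
    using pot by (simp add: pot_def w1_def w2_def w3_def)
  have a_pos: "0 < real a" using a_ge by simp
  have "card B1 * ((3/2) ^ T * (1/3) ^ D) \<le> pot_mini out mini"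
    unfolding pot_mini_def
    using A'(1) by (intro card_weight_le mult_mono power_increasing power_decreasing) (auto simp: B1_def)
  then have "4 / (a * (3/2) ^ T * (1/3) ^ D) * (card B1 * ((3/2) ^ T * (1/3) ^ D)) \<le> w2"
    unfolding w2_def by (intro mult_left_mono) auto
  then have "4 / a * card B1 < 1" using sum nonneg by simp
  then have B1: "4 * real (card B1) < a" using a_pos by (simp add: field_simps) 
  have "(\<Sum>v\<in>{1..n}. out v) \<le> (\<Sum>v\<in>{1..n}. D)"
    using out by (intro sum_mono) auto
  then have "(\<Sum>v\<in>{1..n}. out v) \<le> n * D" by simp
  then have "real (\<Sum>v\<in>{1..n}. out v) \<le> real (n * D)" by (rule of_nat_mono)
  then have "2 / n * real (\<Sum>v\<in>{1..n}. out v) \<le> 2 / n * (n * D)"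
    by (intro mult_left_mono) auto
  then have "0 \<le> 2 * D - 2 / n * real (\<Sum>v\<in>{1..n}. out v)"
    using n_pos by simp
  then have e: "1 \<le> exp (2 * D - 2 / n * real (\<Sum>v\<in>{1..n}. out v))" by simp
  have "real (card B2) * 2 ^ T \<le> (\<Sum>v\<in>{1..n}. 2 ^ inn v :: real)"
    using A'(1) by (intro card_weight_le power_increasing) (auto simp: B2_def)
  also have "\<dots> \<le> pot_in out inn"
    unfolding pot_in_def using mult_right_mono [OF e, of "\<Sum>v\<in>{1..n}. 2 ^ inn v"]
    by (simp add: sum_nonneg)
  finally have "4 / (a * 2 ^ T) * (card B2 * 2 ^ T) \<le> w3"
    unfolding w3_def by (intro mult_left_mono) auto
  then have "4 / a * card B2 < 1" using sum nonneg by simp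
  then have B2: "4 * real (card B2) < a" using a_pos by (simp add: field_simps)
  have B3: "real a / 2 \<le> card B3" using cards B1 B2 by linarith
  have "card B3 * D \<le> (\<Sum>v\<in>B3. out v)"
    using sum_bounded_below [of B3 D out] by (simp add: B3_def)
  also have "\<dots> \<le> (\<Sum>v\<in>A. out v)"
    using A'(3) by (intro sum_mono2) (auto simp: B3_def)
  finally have "real (card B3 * D) \<le> real (\<Sum>v\<in>A. out v)" by (rule of_nat_mono)
  moreover have "real a / 2 * D \<le> real (card B3) * D"
    using B3 by (intro mult_right_mono) auto
  ultimately have "hit * (real a / 2 * D) \<le> hit * real (\<Sum>v\<in>A. out v)"
    using hit_nonneg by (intro mult_left_mono) auto
  then have "exp (hit * (real a / 2 * D)) \<le> exp (hit * real (\<Sum>v\<in>A. out v))" by simp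
  also have "\<dots> \<le> pot_indep G out"
    unfolding pot_indep_def using A by (intro member_le_sum) auto
  finally have "exp (- hit * D * a / 2) * exp (hit * (real a / 2 * D)) \<le> w1"
    unfolding w1_def by (intro mult_left_mono) auto
  then have "1 \<le> w1" by (simp add: exp_add [symmetric] algebra_simps)
  then show False using sum nonneg by linarith
qed

text \<open>In a terminal graph all pairs of differently coloured vertices are edges. A colour class
  with \<open>a\<close> vertices would contain an active vertex, and one more edge from it inside
  the class would be legal. So classes have at most \<open>a - 1\<close> vertices and degrees are at
  least \<open>n - (a - 1)\<close>. The degree hypothesis is weaker than in \<open>inv\<close> so
  that it also holds after an unanswered edge of Mini.\<close>

lemma card_terminal_ge:
  assumes G: "G \<subseteq> all_edges n" "colorable n G k"
    and pot: "pot G out mini inn < 1" and out: "\<forall>v\<in>{1..n}. out v \<le> D"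
    and deg: "\<And>v. active out mini inn v \<Longrightarrow> degree G v \<le> K"
    and terminal: "legal_edges n (chi_gt n k) G = {}"
  shows "n * (n + 1 - a) \<le> 2 * card G"
proof -
  obtain f where f: "f ` {1..n} \<subseteq> {..<k}"
      "\<forall>u\<in>{1..n}. \<forall>v\<in>{1..n}. {u, v} \<in> G \<longrightarrow> f u \<noteq> f v"
    using G(2) unfolding colorable_def by auto
  have complete: "{u, v} \<in> G" if "u \<in> {1..n}" "v \<in> {1..n}" "f u \<noteq> f v" for u v
  proof (rule ccontr)
    assume "{u, v} \<notin> G"
    moreover have "{u, v} \<in> all_edges n" using that by (auto simp: doubleton_in_all_edges)
    moreover have "colorable n (insert {u, v} G) k"
      unfolding colorable_def using f that
      by (intro exI [of _ f]) (auto simp: doubleton_eq_iff)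
    ultimately have "{u, v} \<in> legal_edges n (chi_gt n k) G"
      using G by (simp add: legal_edges_chi_gt)
    then show False using terminal by simp
  qed
  have class_less: "card {u \<in> {1..n}. f u = f v} < a" for v
  proof (rule ccontr)
    assume "\<not> ?thesis"
    then obtain A where A: "A \<subseteq> {u \<in> {1..n}. f u = f v}" "card A = a"
      by (metis (no_types, lifting) not_less obtain_subset_with_card_n)
    have "{x, y} \<notin> G" if "x \<in> A" "y \<in> A" for x y
      using A(1) f(2) that by (metis (mono_tags, lifting) mem_Collect_eq subsetD)
    then have indep: "A \<in> indep G" using A by (auto simp: indep_def)
    have "\<not> active out mini inn x" if x: "x \<in> A" for x
    proof
      assume "active out mini inn x"
      then have "degree G x + 2 \<le> k" using deg K_le by fastforce
      moreover obtain y where y: "y \<in> A" "y \<noteq> x"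
        using A(2) a_ge x by (metis One_nat_def card_1_singleton_iff is_singletonI' is_singleton_def
            empty_iff not_numeral_le_zero numeral_le_one_iff semiring_norm(69))
      ultimately have "colorable n (insert {x, y} G) k"
        using G by (intro colorable_insert_low_degree) auto
      moreover have "{x, y} \<in> all_edges n - G"
        using x y A indep by (auto simp: doubleton_in_all_edges indep_def)
      ultimately have "{x, y} \<in> legal_edges n (chi_gt n k) G"
        using G by (simp add: legal_edges_chi_gt)
      then show False using terminal by simp
    qed
    then show False using no_inactive_indep [OF out pot indep] by blast
  qed
  have "n + 1 - a \<le> degree G v" if v: "v \<in> {1..n}" for v
  proof -
    have fin: "finite G" using G(1) by (rule finite_subset_all_edges)
    have "{v, u} \<in> G" if "u \<in> {1..n}" "f u \<noteq> f v" for u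
      using complete [OF v that(1)] that(2) by auto
    then have "{1..n} \<subseteq> {u \<in> {1..n}. f u = f v} \<union> {u. {v, u} \<in> G}"
      by blast
    then have "card {1..n} \<le> card ({u \<in> {1..n}. f u = f v} \<union> {u. {v, u} \<in> G})"
      using card_neighbours_le_degree [OF fin] by (intro card_mono) auto
    also have "\<dots> \<le> card {u \<in> {1..n}. f u = f v} + card {u. {v, u} \<in> G}"
      by (rule card_Un_le)
    finally show ?thesis
      using class_less [of v] card_neighbours_le_degree(1) [OF fin, of v] by simp
  qed
  then have "(\<Sum>v\<in>{1..n}. n + 1 - a) \<le> (\<Sum>v\<in>{1..n}. degree G v)"
    by (intro sum_mono) auto
  then show ?thesis using sum_degree [OF G(1)] by simp
qed

section \<open>From the initial potential to the score\<close>

lemma pot_initial: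
  "pot {} (\<lambda>_. 0) (\<lambda>_. 0) (\<lambda>_. 0) =
     exp (- hit * D * a / 2) * (n choose a) + 4 * n / (a * (3/2) ^ T * (1/3) ^ D)
       + 4 * n / (a * 2 ^ T) * exp (2 * D)"
proof -
  have "indep {} = {A. A \<subseteq> {1..n} \<and> card A = a}" by (auto simp: indep_def)
  then have "card (indep {}) = n choose a" using n_subsets [of "{1..n}" a] by simp
  then show ?thesis by (simp add: pot_def pot_indep_def pot_mini_def pot_in_def)
qed

lemma score_ge:
  assumes pot0: "pot {} (\<lambda>_. 0) (\<lambda>_. 0) (\<lambda>_. 0) < 1"
  shows "n * (n + 1 - a) \<le> 2 * score n (chi_gt n k) p"
proof -
  \<comment> \<open>\<open>t\<close> is half of the product, rounded up.\<close>
  define t where "t = (n * (n + 1 - a) + 1) div 2"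
  define I where "I G = (\<exists>out mini inn. inv G out mini inn)" for G
  have inv0: "inv {} (\<lambda>_. 0) (\<lambda>_. 0) (\<lambda>_. 0)"
    using pot0 K_le by (auto simp: inv_def colorable_def degree_def intro!: exI [of _ "\<lambda>_. 0"])
  have Mini_moves: "t \<le> game_value n (chi_gt n k) Mini G" if "I G" for G
  proof (rule game_value_ge_invariant [of I])
    fix G assume "I G" "legal_edges n (chi_gt n k) G = {}"
    then obtain out mini inn where inv: "inv G out mini inn" by (auto simp: I_def)
    have "n * (n + 1 - a) \<le> 2 * card G"
      using inv \<open>legal_edges n (chi_gt n k) G = {}\<close>
      by (intro card_terminal_ge [of G out mini inn]) (fastforce simp: inv_def active_def)+
    then show "t \<le> card G" by (simp add: t_def)
  next
    fix G e assume "I G" and e: "e \<in> legal_edges n (chi_gt n k) G"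
      and terminal: "legal_edges n (chi_gt n k) (insert e G) = {}"
    then obtain out mini inn where inv: "inv G out mini inn" by (auto simp: I_def)
    have G: "G \<subseteq> all_edges n" using inv by (simp add: inv_def)
    have "n * (n + 1 - a) \<le> 2 * card (insert e G)"
    proof (rule card_terminal_ge [OF _ _ _ _ _ terminal])
      show "insert e G \<subseteq> all_edges n" "colorable n (insert e G) k"
        using e G by (auto simp: legal_edges_chi_gt)
      show "pot (insert e G) out mini inn < 1" "\<forall>v\<in>{1..n}. out v \<le> D"
        using inv pot_antimono [OF subset_insertI [of G e], of out mini inn] by (auto simp: inv_def)
      show "degree (insert e G) v \<le> K" if "active out mini inn v" for v
        using inv that degree_insert_le [OF finite_subset_all_edges [OF G], of e v]
        by (fastforce simp: inv_def active_def split: if_splits)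
    qed
    then show "t \<le> card (insert e G)" by (simp add: t_def)
  next
    fix G e assume "I G" "e \<in> legal_edges n (chi_gt n k) G"
      "legal_edges n (chi_gt n k) (insert e G) \<noteq> {}"
    then show "\<exists>e'\<in>legal_edges n (chi_gt n k) (insert e G). I (insert e' (insert e G))"
      unfolding I_def using inv_step by blast
  qed (use that in auto)
  have "t \<le> score n (chi_gt n k) p"
  proof (cases p)
    case Mini
    then show ?thesis using Mini_moves [of "{}"] inv0 by (auto simp: score_def I_def)
  next
    case Maxi
    \<comment> \<open>Max opens with an edge sent out from vertex 1, as if answering a move that
      changed nothing.\<close>
    have "\<exists>e\<in>legal_edges n (chi_gt n k) {}. \<exists>out inn. inv (insert e {}) out (\<lambda>_. 0) inn"
      using inv0 pot0 n_pos D_pos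
      by (intro Max_reply [of "{}" "\<lambda>_. 0" "\<lambda>_. 0" "\<lambda>_. 0" 1] pot_mini_out_le)
         (auto simp: inv_def degree_def)
    then obtain e where e: "e \<in> legal_edges n (chi_gt n k) {}" "I {e}"
      by (auto simp: I_def)
    then show ?thesis
      using Mini_moves [OF e(2)] game_value_Maxi_ge [OF e(1)] Maxi by (simp add: score_def)
  qed
  then show ?thesis by (simp add: t_def)
qed

end

section \<open>Choice of the parameters\<close>

text \<open>The left side times \<open>(a / n) ^ a\<close> is a single term of the expansion of
  \<open>(a / n + 1) ^ n\<close>, which is at most \<open>exp a\<close>.\<close>

lemma binomial_le_exp_power:
  assumes "0 < a" "a \<le> n"
  shows "real (n choose a) \<le> (exp 1 * n / a) ^ a"
proof -
  have "real (n choose a) * (a / n) ^ a = (n choose a) * (a / n) ^ a * 1 ^ (n - a)" by simp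
  also have "\<dots> \<le> (\<Sum>j\<le>n. (n choose j) * (a / n) ^ j * 1 ^ (n - j))"
    using assms by (intro member_le_sum) auto
  also have "\<dots> = (a / n + 1) ^ n"
    by (rule binomial_ring [symmetric])
  also have "\<dots> \<le> exp (a / n) ^ n"
    using exp_ge_add_one_self [of "a / n"] by (intro power_mono) (auto simp: add.commute)
  also have "\<dots> = exp 1 ^ a"
    using assms by (simp add: exp_of_nat_mult [symmetric])
  finally have "real (n choose a) * (a / n) ^ a * (n / a) ^ a \<le> exp 1 ^ a * (n / a) ^ a"
    by (intro mult_right_mono) auto
  moreover have "(a / n) ^ a * (real n / a) ^ a = 1"
    using assms by (simp add: power_mult_distrib [symmetric])
  ultimately have "real (n choose a) \<le> exp 1 ^ a * (n / a) ^ a"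
    by (simp only: mult.assoc mult_1_right)
  then show ?thesis by (simp add: power_mult_distrib power_divide)
qed

lemma (in colouring_game) pot_initial_less_1:
  fixes L :: real
  defines "L \<equiv> 9600 * (ln k / k)"
  assumes T: "T = 10 * D" and kD: "k \<le> 60 * D" and a: "L * (real n - 1) \<le> a"
  shows "pot {} (\<lambda>_. 0) (\<lambda>_. 0) (\<lambda>_. 0) < 1"
proof -
  have k: "2 \<le> k" using K_le by simp
  have n: "2 \<le> n" "0 < real n" using a_ge a_le by auto
  have apos: "0 < real a" using a_ge by simp
  have D: "1 \<le> real D" using D_pos by simp
  have "1 / 2 \<le> ln (2 :: real)" using ln_le_minus_one [of "1 / 2 :: real"] by (simp add: ln_div)
  also have "\<dots> \<le> ln k" using k by simp
  finally have lnk: "1 / 2 \<le> ln k" .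
  have Lpos: "0 < L" using lnk k by (simp add: L_def)
  have "L * (n / 2) \<le> L * (real n - 1)" using n Lpos by (intro mult_left_mono) auto
  then have aL: "L * n \<le> 2 * a" using a by simp
  have "4800 \<le> L * k" using lnk k by (simp add: L_def)
  also have "\<dots> \<le> L * (60 * D)" using kD Lpos by (intro mult_left_mono) auto
  \<comment> \<open>The constant 9600 is spent here and in \<open>16 * ln k \<le> L * D\<close>: the
    first makes \<open>n / a\<close> at most \<open>D / 40\<close>, the second makes
    \<open>exp (- (hit * D / 2))\<close> at most \<open>1 / k ^ 2\<close>.\<close>
  finally have LD: "80 \<le> L * D" by simp
  have "80 * real n \<le> L * D * n" using LD by (intro mult_right_mono) auto
  also have "\<dots> = (L * n) * D" by simp
  also have "\<dots> \<le> (2 * real a) * D" using aL by (intro mult_right_mono) auto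
  finally have na: "n / a \<le> D / 40" using apos by (simp add: field_simps)
  have "real D \<le> 2 ^ D" using of_nat_less_two_power [of D] less_imp_le by fastforce
  then have na': "4 * (n / a) \<le> 1 / 10 * 2 ^ D" using na by linarith
  have "exp (- hit * D * a / 2) * (n choose a) \<le> 1 / 2"
  proof -
    \<comment> \<open>Since \<open>a\<close> is at least 2, \<open>a - 1\<close> is at least
      \<open>a / 2\<close>.\<close>
    have "L * n / 4 \<le> real (a - 1)" using aL a_ge by simp
    then have "L / 4 \<le> hit" using n by (simp add: hit_def field_simps)
    then have "L / 4 * D \<le> hit * D" by (intro mult_right_mono) auto
    moreover have "16 * ln k \<le> L * D"
    proof -
      have "160 * k * ln k \<le> 9600 * D * ln k" using kD lnk by (intro mult_right_mono) auto
      then show ?thesis using k lnk by (simp add: L_def field_simps)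
    qed
    ultimately have "2 * ln k \<le> hit * D / 2" by simp
    then have "exp (- (hit * D / 2)) \<le> exp (- (ln k + ln k))" by simp
    also have "\<dots> = 1 / (real k * k)" 
      using k unfolding exp_minus exp_add by (simp add: inverse_eq_divide)
    finally have e: "exp (- (hit * D / 2)) \<le> 1 / (real k * k)" .
    have Dk: "real D \<le> k" using K_le K_def by simp
    have "exp 1 * (n / a) \<le> 3 * (D / 40)" using na exp_le by (intro mult_mono) auto
    also have "\<dots> \<le> k" using Dk D by simp
    finally have "exp (- (hit * D / 2)) * (exp 1 * (n / a)) \<le> 1 / (real k * k) * k"
      using e by (intro mult_mono) auto
    also have "\<dots> \<le> 1 / 2" using k by (simp add: field_simps)
    \<comment> \<open>Per vertex of the set, the decay beats the factor
      \<open>exp 1 * (n / a)\<close> from the number of \<open>a\<close>-sets; the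
      \<open>a\<close>-th power then handles whole sets.\<close>
    finally have base: "exp (- (hit * D / 2)) * (exp 1 * (n / a)) \<le> 1 / 2" .
    have "exp (- hit * D * a / 2) * (n choose a) \<le> exp (- hit * D * a / 2) * (exp 1 * n / a) ^ a"
      using a_ge a_le by (intro mult_left_mono binomial_le_exp_power) auto
    also have "\<dots> = (exp (- (hit * D / 2)) * (exp 1 * (n / a))) ^ a"
      by (simp add: power_mult_distrib power_divide exp_of_nat_mult [symmetric] mult_ac)
    also have "\<dots> \<le> (1 / 2) ^ a" using base by (intro power_mono) auto
    also have "\<dots> \<le> (1 / 2) ^ 1" using a_ge by (intro power_decreasing) auto
    finally show ?thesis by simp
  qed
  moreover have "4 * n / (a * (3/2) ^ T * (1/3) ^ D) \<le> 1 / 10"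
  proof -
    \<comment> \<open>\<open>T = 10 * D\<close> suffices because \<open>(3/2) ^ 10 / 3\<close>
      exceeds 19.\<close>
    have "(2::real) ^ D \<le> ((3/2) ^ 10 * (1/3)) ^ D"
      by (intro power_mono) (auto simp: power_divide)
    also have "\<dots> = (3/2) ^ T * (1/3) ^ D" by (simp only: T power_mult_distrib power_mult)
    finally have r: "2 ^ D \<le> (3/2) ^ T * (1/3 :: real) ^ D" .
    note na'
    also have "1 / 10 * 2 ^ D \<le> (1 / 10 :: real) * ((3/2) ^ T * (1/3) ^ D)" using r by simp
    finally show ?thesis using apos by (simp add: field_simps)
  qed
  moreover have "4 * n / (a * 2 ^ T) * exp (2 * D) \<le> 1 / 10"
  proof -
    have "exp (2 * D) = (exp 1 ^ 2) ^ D"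
      by (simp add: power_mult [symmetric] exp_of_nat_mult [symmetric])
    also have "\<dots> \<le> (3 ^ 2) ^ D" using exp_le by (intro power_mono) auto
    finally have "2 ^ D * exp (2 * D) \<le> 2 ^ D * (3 ^ 2) ^ D" by simp
    also have "\<dots> = (18 :: real) ^ D" by (simp add: power_mult_distrib [symmetric])
    also have "\<dots> \<le> (2 ^ 10) ^ D" by (intro power_mono) auto
    also have "\<dots> = 2 ^ T" by (simp only: T power_mult)
    finally have r: "2 ^ D * exp (2 * D) \<le> (2 :: real) ^ T" .
    have "4 * (n / a) * exp (2 * D) \<le> 1 / 10 * 2 ^ D * exp (2 * D)"
      using na' by (intro mult_right_mono) auto
    also have "\<dots> \<le> 1 / 10 * 2 ^ T" using r by simp
    finally show ?thesis using apos by (simp add: field_simps)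
  qed
  ultimately show ?thesis unfolding pot_initial by simp
qed

lemma score_chi_gt_ge:
  fixes k :: nat and L :: real
  defines "L \<equiv> 9600 * (ln k / k)"
  assumes k: "k \<ge> 2" and L: "L < 1"
    and n: "2 * k \<le> n" "2 \<le> L * (real n - 1)"
  shows "(1 - L) * (n choose 2) \<le> score n (chi_gt n k) p"
proof -
  have "1 / 2 \<le> ln (2 :: real)" using ln_le_minus_one [of "1 / 2 :: real"] by (simp add: ln_div)
  also have "\<dots> \<le> ln k" using k by simp
  finally have "4800 \<le> 9600 * ln k" by simp
  also have "\<dots> < k" using L k by (simp add: L_def field_simps)
  finally have k_large: "4800 < k" by simp
  \<comment> \<open>As \<open>k\<close> exceeds 4800, \<open>D\<close> lies between
    \<open>k / 60\<close> and \<open>k / 30\<close>, and \<open>K = 21 * D\<close> leaves room for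
    \<open>K + 2 \<le> k\<close>.\<close>
  define D where "D = k div 30"
  have D: "0 < D" "30 * D \<le> k" "k \<le> 60 * D" using k_large by (auto simp: D_def)
  \<comment> \<open>The floor plus one keeps \<open>a\<close> at least \<open>L * (n - 1)\<close>,
    as the potential needs, and at most \<open>L * (n - 1) + 1\<close>, which is at most
    \<open>n\<close>. The factor \<open>n - 1\<close> matches \<open>n choose 2\<close>.\<close>
  define a where "a = nat \<lfloor>L * (real n - 1)\<rfloor> + 1"
  have a: "L * (real n - 1) \<le> a" "real a \<le> L * (real n - 1) + 1"
    using n(2) unfolding a_def by linarith+
  have "L * (real n - 1) \<le> 1 * (real n - 1)"
    using L n k by (intro mult_right_mono) auto
  then have "real a \<le> real n" using a(2) by simp
  then have "a \<le> n" by simp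
  interpret colouring_game n k D "10 * D" "21 * D" a
    using D k_large n a \<open>a \<le> n\<close> by unfold_locales auto
  have "n * (n + 1 - a) \<le> 2 * score n (chi_gt n k) p"
    using D a by (intro score_ge pot_initial_less_1) (auto simp: L_def)
  then have "real (n * (n + 1 - a)) \<le> real (2 * score n (chi_gt n k) p)"
    by (rule of_nat_mono)
  then have "real n * real (n + 1 - a) \<le> 2 * real (score n (chi_gt n k) p)"
    by (simp only: of_nat_mult of_nat_numeral)
  moreover have "real n * (real n - 1 - L * (real n - 1)) \<le> real n * real (n + 1 - a)"
    using a \<open>a \<le> n\<close> by (intro mult_left_mono) (auto simp: of_nat_diff)
  moreover have choose: "real (n choose 2) = real n * (real n - 1) / 2"
  proof -
    have "even (n * (n - 1))" by (cases n) auto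
    then have "real (n * (n - 1) div 2) = real (n * (n - 1)) / 2"
      by (metis of_nat_numeral real_of_nat_div)
    then show ?thesis using n k by (simp add: choose_two of_nat_diff)
  qed
  ultimately show ?thesis unfolding choose by (simp add: algebra_simps)
qed

theorem theorem1p5:
  "\<exists>C :: real. \<forall>k :: nat. k \<ge> 2 \<longrightarrow> (\<exists>n0 :: nat. \<forall>n \<ge> n0. \<forall>first :: player.
     real (score n (chi_gt n k) first) \<ge> (1 - C * (ln (real k) / real k)) * real (n choose 2))"
proof (rule exI [of _ 9600], intro allI impI)
  fix k :: nat assume k: "k \<ge> 2"
  define L where "L = 9600 * (ln k / k)"
  have Lpos: "0 < L" using k by (simp add: L_def)
  have "(1 - L) * (n choose 2) \<le> score n (chi_gt n k) first"
    \<comment> \<open>The summands ensure \<open>2 * k \<le> n\<close> and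
      \<open>2 \<le> L * (n - 1)\<close>.\<close>
    if "n \<ge> 2 * k + nat \<lceil>2 / L\<rceil> + 1" for n first
  proof (cases "L < 1")
    case True
    have "2 / L \<le> real n - 1" using that by linarith
    then have "2 \<le> L * (real n - 1)" using Lpos by (simp add: field_simps)
    then show ?thesis using score_chi_gt_ge [of k n first] True k that by (simp add: L_def)
  next
    \<comment> \<open>For \<open>L\<close> at least 1 the claimed bound is not positive.\<close>
    case False
    then have "(1 - L) * (n choose 2) \<le> 0" by (intro mult_nonpos_nonneg) auto
    then show ?thesis by (meson of_nat_0_le_iff order_trans)
  qed
  then show "\<exists>n0. \<forall>n\<ge>n0. \<forall>first. (1 - 9600 * (ln (real k) / real k)) * real (n choose 2)
      \<le> real (score n (chi_gt n k) first)"
    unfolding L_def by blast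
qed

end
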